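(* Let $T\subset\mathbb{R}^3$ be a (non-degenerate) tetrahedron with vertices $\texttt{v}_0,\texttt{v}_1,\texttt{v}_2,\texttt{v}_3$, and let $$\Phi(T):=\mathbb{P}_1(T;\mathbb{R}^3)\oplus\nabla\big(b_T\,\mathbb{P}_1(T)\big),\qquad b_T=\lambda_0\lambda_1\lambda_2\lambda_3 .$$ Then the degrees of freedom $$\int_e(\boldsymbol{v}\cdot\boldsymbol{t})\,q\,\mathrm{d}s\quad\text{for all } q\in\mathbb{P}_1(e)\text{ and all edges } e \text{ of } T,\qquad \int_F\boldsymbol{v}\cdot\boldsymbol{n}\,\mathrm{d}S\quad\text{for all faces } F \text{ of } T,$$ are unisolvent for the shape function space $\Phi(T)$.
   Context: $\mathbb{P}_k(D)$ is the space of polynomials on $D$ of total degree at most $k$, and $\mathbb{P}_k(D;\mathbb{R}^3)=\mathbb{P}_k(D)\otimes\mathbb{R}^3$. $\lambda_i$ is the barycentric coordinate of $T$ associated with the vertex $\texttt{v}_i$. $\boldsymbol{t}$ is a fixed unit tangent vector of the edge $e$, and $\boldsymbol{n}$ a fixed unit normal vector of the face $F$. Unisolvent means: the number of degrees of freedom (taking a basis of $\mathbb{P}_1(e)$ for each edge $e$) equals $\dim\Phi(T)$, and an element of $\Phi(T)$ for which all the degrees of freedom vanish is zero. *)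

theory Defs
  imports "HOL-Analysis.Analysis" "HOL-Library.Function_Algebras"
begin

text \<open>Pointwise scalar multiplication, so that \<^const>\<open>span\<close> and
  \<^const>\<open>dim\<close> are available for spaces of functions.\<close>

instantiation "fun" :: (type, real_vector) real_vector
begin

definition scaleR_fun :: "real \<Rightarrow> ('a \<Rightarrow> 'b) \<Rightarrow> 'a \<Rightarrow> 'b"
  where "scaleR_fun c f = (\<lambda>x. c *\<^sub>R f x)"

instance
  by standard (simp_all add: scaleR_fun_def fun_eq_iff scaleR_add_right scaleR_add_left)

end

text \<open>A function on a set \<open>D\<close> is represented by the total function that vanishes
  outside \<open>D\<close>, so that functions on \<open>D\<close> are equal iff they agree on \<open>D\<close>.\<close>

definition restr :: "'a set \<Rightarrow> ('a \<Rightarrow> 'b) \<Rightarrow> 'a \<Rightarrow> 'b::zero"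
  where "restr D f = (\<lambda>x. if x \<in> D then f x else 0)"

definition monomial_fun :: "('n::finite \<Rightarrow> nat) \<Rightarrow> real^'n \<Rightarrow> real"
  where "monomial_fun \<alpha> x = (\<Prod>i\<in>UNIV. (x $ i) ^ \<alpha> i)"

definition polys_on :: "nat \<Rightarrow> (real^'n::finite) set \<Rightarrow> (real^'n \<Rightarrow> real) set"
  where "polys_on k D = restr D ` span {monomial_fun \<alpha> |\<alpha>. sum \<alpha> UNIV \<le> k}"

definition vpolys_on :: "nat \<Rightarrow> (real^3) set \<Rightarrow> (real^3 \<Rightarrow> real^3) set"
  where "vpolys_on k D = {u. \<forall>i. (\<lambda>x. u x $ i) \<in> polys_on k D}"

text \<open>The derivative within \<open>D\<close> (rather than at the point) gives the one-sided
  gradient on the boundary of \<open>D\<close>; it is uniquely determined when \<open>D\<close> is convex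
  with nonempty interior.\<close>

definition grad_on :: "(real^3) set \<Rightarrow> (real^3 \<Rightarrow> real) \<Rightarrow> real^3 \<Rightarrow> real^3"
  where "grad_on D f =
    restr D (\<lambda>x. \<chi> i. frechet_derivative f (at x within D) (axis i 1))"

definition barycentric :: "(4 \<Rightarrow> real^3) \<Rightarrow> 4 \<Rightarrow> real^3 \<Rightarrow> real"
  where "barycentric v i x =
    (THE c. sum c UNIV = 1 \<and> (\<Sum>j\<in>UNIV. c j *\<^sub>R v j) = x) i"

definition bubble :: "(4 \<Rightarrow> real^3) \<Rightarrow> real^3 \<Rightarrow> real"
  where "bubble v x = (\<Prod>i\<in>UNIV. barycentric v i x)"

definition grad_bubble_space :: "(4 \<Rightarrow> real^3) \<Rightarrow> (real^3 \<Rightarrow> real^3) set"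
  where "grad_bubble_space v =
    (let T = convex hull (range v)
     in (\<lambda>p. grad_on T (\<lambda>x. bubble v x * p x)) ` polys_on 1 T)"

definition Phi :: "(4 \<Rightarrow> real^3) \<Rightarrow> (real^3 \<Rightarrow> real^3) set"
  where "Phi v =
    {u + w |u w. u \<in> vpolys_on 1 (convex hull (range v)) \<and> w \<in> grad_bubble_space v}"

text \<open>Integration over a flat piece \<open>M\<close> of dimension \<open>DIM('k)\<close> with respect to
  arc length or surface area: \<open>M\<close> is pulled back to \<open>'k\<close> along a
  distance-preserving parametrization of its affine hull. The value does not depend
  on the choice of the parametrization, because two of them differ by an isometry
  of \<open>'k\<close>, which preserves Lebesgue measure.\<close>

definition isometric_param ::
    "(real^3) set \<Rightarrow> ('k::euclidean_space \<Rightarrow> real^3) \<Rightarrow> bool"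
  where "isometric_param M \<phi> \<longleftrightarrow>
    (\<forall>x y. dist (\<phi> x) (\<phi> y) = dist x y) \<and> range \<phi> = affine hull M"

definition flat_integral ::
    "'k::euclidean_space itself \<Rightarrow> (real^3) set \<Rightarrow> (real^3 \<Rightarrow> real) \<Rightarrow> real"
  where "flat_integral _ M f =
    (let \<phi> = (SOME \<phi> :: 'k \<Rightarrow> real^3. isometric_param M \<phi>)
     in integral (\<phi> -` M) (\<lambda>y. f (\<phi> y)))"

abbreviation line_integral :: "(real^3) set \<Rightarrow> (real^3 \<Rightarrow> real) \<Rightarrow> real"
  where "line_integral \<equiv> flat_integral TYPE(real)"

abbreviation surface_integral :: "(real^3) set \<Rightarrow> (real^3 \<Rightarrow> real) \<Rightarrow> real"
  where "surface_integral \<equiv> flat_integral TYPE(real^2)"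

definition unit_tangent :: "(real^3) set \<Rightarrow> real^3 \<Rightarrow> bool"
  where "unit_tangent e t \<longleftrightarrow> norm t = 1 \<and> t \<in> span {x - y |x y. x \<in> e \<and> y \<in> e}"

definition unit_normal :: "(real^3) set \<Rightarrow> real^3 \<Rightarrow> bool"
  where "unit_normal F n \<longleftrightarrow> norm n = 1 \<and> (\<forall>x\<in>F. \<forall>y\<in>F. n \<bullet> (x - y) = 0)"

end

theory Submission
  imports Defs
begin

text \<open>On the edges the field \<open>\<nabla>(b p)\<close> vanishes, because every term of the gradient keeps one of
  the two barycentric coordinates that are zero there. Hence the tangential edge moments see only
  the linear part \<open>r\<close>: the affine function \<open>r \<bullet> t\<close> is orthogonal to itself, so at each vertex \<open>r\<close>
  is orthogonal to three independent edge directions, and \<open>r = 0\<close>. On the face opposite to the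
  vertex \<open>i\<close>, \<open>\<nabla>(b p)\<close> is \<open>p\<close> times the face bubble times \<open>\<nabla>\<lambda>\<^sub>i\<close>. By symmetry the face bubble
  weights the three vertex values of \<open>p\<close> equally, so a zero flux means that these values sum to
  zero; over the four faces this forces \<open>p = 0\<close>. Applied to the zero field, the same argument shows that
  the parametrization of \<open>\<Phi>(T)\<close> by the vertex values of \<open>r\<close> and \<open>p\<close> is injective, which gives the
  dimension 16 and the directness of the sum.\<close>


section \<open>Integrals over compact sets, one-sided derivatives and isometries\<close>

lemma absolutely_integrable_continuous_compact:
  fixes f :: "'a::euclidean_space \<Rightarrow> 'b::euclidean_space"
  assumes "compact K" "continuous_on K f"
  shows "f absolutely_integrable_on K"
proof -
  have "set_integrable lborel K f"
    using borel_integrable_compact[OF assms] unfolding set_integrable_def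
    by (simp add: indicator_scaleR_eq_if)
  then show ?thesis
    by (auto simp: set_integrable_def intro: integrable_completion[THEN iffD2])
qed

text \<open>A box around \<open>y\<close> lies in \<open>K\<close>, and nonnegativity squeezes its
  integral between 0 and the integral over \<open>K\<close>; on a box a continuous nonnegative
  function with integral 0 vanishes.\<close>

lemma continuous_nonneg_integral_0_imp_0:
  fixes f :: "'a::euclidean_space \<Rightarrow> real"
  assumes K: "compact K" "continuous_on K f" and nonneg: "\<And>y. y \<in> K \<Longrightarrow> 0 \<le> f y"
    and int: "integral K f = 0" and "open O'" "O' \<subseteq> K" "y \<in> O'"
  shows "f y = 0"
proof -
  obtain a b where ab: "y \<in> box a b" "cbox a b \<subseteq> O'"
    by (meson assms(5,7) open_contains_cbox)
  have sub: "cbox a b \<subseteq> K" using ab assms(6) by blast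
  have cont: "continuous_on (cbox a b) f" using K(2) sub continuous_on_subset by blast
  have "f integrable_on K"
    using absolutely_integrable_continuous_compact[OF K] set_lebesgue_integral_eq_integral(1) by blast
  then have "integral (cbox a b) f \<le> integral K f"
    using sub cont nonneg by (intro integral_subset_le integrable_continuous) auto
  moreover have "0 \<le> integral (cbox a b) f"
    using sub cont nonneg by (intro integral_nonneg integrable_continuous) auto
  ultimately have "(f has_integral 0) (cbox a b)"
    using integrable_continuous[OF cont] int by (simp add: has_integral_iff)
  then show ?thesis
    using has_integral_0_cbox_imp_0[OF cont, of y] ab sub nonneg box_subset_cbox[of a b] by (auto simp: subset_eq)
qed

text \<open>Since \<open>A\<close> is an involution, \<open>L (L x) = x\<close>; hence the
  determinant squares to 1 and the Jacobian factor of the substitution is 1.\<close>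

lemma integral_affine_involution:
  fixes A L :: "real^'n::{finite,wellorder} \<Rightarrow> real^'n::_" and f :: "real^'n::_ \<Rightarrow> real"
  assumes K: "compact K" "continuous_on K f"
    and lin: "linear L" and aff: "\<And>x y. A x - A y = L (x - y)"
    and inv: "\<And>x. A (A x) = x" and AK: "A ` K \<subseteq> K"
  shows "integral K (\<lambda>x. f (A x)) = integral K f"
proof -
  have "A ` K = K"
    using AK inv by (metis image_eqI subsetI subset_antisym image_subset_iff)
  have "L (L x) = x" for x
  proof -
    have "L (L x) = A (A x) - A (A 0)" using aff[of "A x" "A 0"] aff[of x 0] by simp
    then show ?thesis by (simp add: inv)
  qed
  then have "matrix L ** matrix L = mat 1"
    using matrix_compose[OF lin lin] by (simp add: o_def matrix_id_mat_1 [unfolded id_def])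
  then have "det (matrix L) * det (matrix L) = 1"
    by (metis det_I det_mul)
  then have det: "\<bar>det (matrix L)\<bar> = 1"
    by (metis abs_1 square_eq_1_iff abs_minus_cancel)
  have eq: "A = (\<lambda>x. A 0 + L x)" 
  proof
    show "A x = A 0 + L x" for x using aff[of x 0] by (metis add.commute diff_add_cancel diff_zero)
  qed
  have der: "(A has_derivative L) (at x within K)" for x
    by (subst eq) (auto intro!: derivative_eq_intros linear_imp_has_derivative lin)
  have "inj_on A K" by (metis inj_onI inv)
  have "K \<in> sets lebesgue" using K(1) by (simp add: lmeasurable_compact fmeasurableD)
  \<comment> \<open>The integrand is placed in \<open>real^1\<close>, the form in which the
    substitution rule takes it; \<open>integral_on_1_eq\<close> undoes this at the end.\<close>
  moreover have "(\<lambda>x. \<chi> i. f x :: real^1) absolutely_integrable_on A ` K"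
    unfolding \<open>A ` K = K\<close>
    using K by (intro absolutely_integrable_continuous_compact continuous_intros)
  ultimately have "integral (A ` K) (\<lambda>x. \<chi> i. f x :: real^1) =
      integral K (\<lambda>x. \<bar>det (matrix L)\<bar> *\<^sub>R (\<chi> i. f (A x)))"
    using integral_change_of_variables[OF _ der \<open>inj_on A K\<close>] by blast
  then show ?thesis
    unfolding det \<open>A ` K = K\<close> by (simp add: integral_on_1_eq vec_eq_iff)
qed

text \<open>Makes the gradient within the tetrahedron unique at boundary points too. Along the
  segment from \<open>x\<close> to \<open>y\<close> in \<open>S\<close>, the difference of the
  derivatives is a one-sided derivative of the zero function, so it vanishes at
  \<open>y - x\<close>; the \<open>y\<close> with this property form an affine set, hence are all
  points.\<close>

lemma has_derivative_unique_within_convex: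
  fixes f :: "'a::euclidean_space \<Rightarrow> 'b::real_normed_vector"
  assumes "convex S" "x \<in> S" "affine hull S = UNIV"
    and f': "(f has_derivative f') (at x within S)" and f'': "(f has_derivative f'') (at x within S)"
  shows "f' = f''"
proof -
  let ?d = "\<lambda>h. f' h - f'' h"
  have d: "((\<lambda>x. 0) has_derivative ?d) (at x within S)"
    using has_derivative_diff[OF f' f''] by simp
  have lin: "linear ?d"
    using has_derivative_linear[OF d] .
  have z: "?d (y - x) = 0" if "y \<in> S" for y
  proof -
    let ?g = "\<lambda>s::real. x + s *\<^sub>R (y - x)"
    have "?g ` {0..1} \<subseteq> S"
    proof clarify
      fix s :: real assume "s \<in> {0..1}"
      then have "(1 - s) *\<^sub>R x + s *\<^sub>R y \<in> S"
        using assms(1,2) that by (simp add: convexD_alt)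
      then show "?g s \<in> S" by (simp add: algebra_simps)
    qed
    then have "((\<lambda>x. 0) has_derivative ?d) (at (?g 0) within ?g ` {0..1})"
      using has_derivative_subset[OF d] by simp
    moreover have "(?g has_derivative (\<lambda>s. s *\<^sub>R (y - x))) (at 0 within {0..1})"
      by (auto intro!: derivative_eq_intros)
    ultimately have "((\<lambda>s::real. 0) has_derivative (\<lambda>s. ?d (s *\<^sub>R (y - x)))) (at 0 within {0..1})"
      using has_derivative_in_compose by fastforce
    then have "((\<lambda>s::real. 0) has_vector_derivative ?d (y - x)) (at 0 within {0..1})"
      by (simp add: has_vector_derivative_def linear_scale[OF lin])
    moreover have "((\<lambda>s::real. 0) has_vector_derivative 0) (at 0 within {0..1})" by simp
    ultimately show ?thesis
      by (metis atLeastAtMost_iff cbox_interval order_refl right_minus_eq vector_derivative_unique_within_closed_interval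
          zero_less_one zero_le_one)
  qed
  have "affine {y. ?d (y - x) = 0}"
    unfolding affine_def
  proof (clarify)
    fix y z u v
    assume yz: "?d (y - x) = 0" "?d (z - x) = 0" and uv: "u + v = (1::real)"
    have "u *\<^sub>R y + v *\<^sub>R z - x = u *\<^sub>R (y - x) + v *\<^sub>R (z - x)"
      using uv by (simp add: algebra_simps) (metis scaleR_add_left scaleR_one)
    then show "?d (u *\<^sub>R y + v *\<^sub>R z - x) = 0"
      using yz linear_add[OF lin, of "u *\<^sub>R (y - x)" "v *\<^sub>R (z - x)"]
        linear_scale[OF lin, of u "y - x"] linear_scale[OF lin, of v "z - x"] by simp
  qed
  then have "affine hull S \<subseteq> {y. ?d (y - x) = 0}"
    using z by (intro hull_minimal) auto
  then have "?d (y - x) = 0" for y using assms(3) by blast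
  then have "?d h = 0" for h by (metis add_diff_cancel_right')
  then show ?thesis by (simp add: fun_eq_iff)
qed

text \<open>The affine hull, shifted by a point of \<open>M\<close>, is a subspace of dimension
  \<open>DIM('k)\<close>, hence a linear isometric image of \<open>'k\<close>. This makes the
  \<open>SOME\<close> in \<open>flat_integral\<close> meaningful.\<close>

lemma isometric_param_exists:
  fixes M :: "(real^3) set"
  assumes "aff_dim M = int DIM('k::euclidean_space)"
  shows "\<exists>\<phi>::'k \<Rightarrow> real^3. isometric_param M \<phi>"
proof -
  obtain a where a: "a \<in> M" using assms aff_dim_empty[of M] DIM_positive[where 'a='k] by fastforce
  let ?S = "(\<lambda>x. - a + x) ` (affine hull M)"
  have "subspace ?S" 
    using a by (intro affine_diffs_subspace) (auto simp: hull_inc)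
  moreover have "dim ?S = DIM('k)"
    using aff_dim_dim_affine_diffs[of "affine hull M" a] a assms by (auto simp: hull_inc)
  ultimately obtain f :: "'k \<Rightarrow> real^3" where f: "linear f" "f ` UNIV = ?S" "\<And>x. norm (f x) = norm x"
    using isometry_subspaces[of "UNIV::'k set" ?S] by (metis UNIV_I dim_UNIV subspace_UNIV)
  have "isometric_param M (\<lambda>y. a + f y)"
    unfolding isometric_param_def
  proof
    show "\<forall>x y. dist (a + f x) (a + f y) = dist x y"
      by (simp add: dist_norm f(3) linear_diff[OF f(1), symmetric])
    have "range (\<lambda>y. a + f y) = (\<lambda>x. a + x) ` ?S" by (subst f(2)[symmetric]) (simp add: image_image)
    then show "range (\<lambda>y. a + f y) = affine hull M" by (simp add: image_image)
  qed
  then show ?thesis by blast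
qed

text \<open>Distances determine inner products by polarization, so the defects of additivity and
  homogeneity are orthogonal to themselves.\<close>

lemma isometry_affine:
  fixes \<phi> :: "'a::real_inner \<Rightarrow> 'b::real_inner"
  assumes iso: "\<And>x y. dist (\<phi> x) (\<phi> y) = dist x y"
  shows "linear (\<lambda>x. \<phi> x - \<phi> 0)"
proof -
  define h where "h x = \<phi> x - \<phi> 0" for x
  have d: "norm (h x - h y) = norm (x - y)" for x y
    using iso[of x y] by (simp add: h_def dist_norm)
  have n: "norm (h x) = norm x" for x using d[of x 0] by (simp add: h_def)
  have ip: "h x \<bullet> h y = x \<bullet> y" for x y
  proof -
    have "(norm (h x - h y))\<^sup>2 = (norm (x - y))\<^sup>2" by (simp add: d)
    then show ?thesis
      using n[of x] n[of y]
      by (simp add: power2_norm_eq_inner inner_diff_left inner_diff_right inner_commute norm_eq)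
  qed
  show ?thesis
  proof
    show "\<phi> (x + y) - \<phi> 0 = (\<phi> x - \<phi> 0) + (\<phi> y - \<phi> 0)" for x y
    proof -
      let ?w = "h (x + y) - h x - h y"
      have "?w \<bullet> ?w = 0" by (simp add: inner_diff_left inner_diff_right inner_add_left inner_add_right ip inner_commute)
      then have "?w = 0" by (simp only: inner_eq_zero_iff)
      then show ?thesis by (simp add: h_def algebra_simps)
    qed
    show "\<phi> (r *\<^sub>R x) - \<phi> 0 = r *\<^sub>R (\<phi> x - \<phi> 0)" for r x
    proof -
      let ?w = "h (r *\<^sub>R x) - r *\<^sub>R h x"
      have "?w \<bullet> ?w = 0" by (simp add: inner_diff_left inner_diff_right ip inner_commute)
      then have "?w = 0" by (simp only: inner_eq_zero_iff)
      then show ?thesis by (simp add: h_def algebra_simps)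
    qed
  qed
qed


section \<open>Dimensions, affine functions and the chosen parametrization\<close>

text \<open>The target is a general vector space because the images in question are spaces of
  functions; a basis of \<open>V\<close> is carried over.\<close>

lemma dim_linear_image_inj:
  fixes f :: "'a::euclidean_space \<Rightarrow> 'b::real_vector"
  assumes "linear f" "inj_on f V" "subspace V"
  shows "dim (f ` V) = dim V"
proof -
  obtain B where B: "B \<subseteq> V" "independent B" "V \<subseteq> span B" "card B = dim V"
    using basis_exists by blast
  then have sp: "span B = V" using assms(3) by (metis span_minimal subset_antisym)
  have "independent (f ` B)"
    using assms(1,2) B(2) sp by (simp add: linear_independent_injective_image)
  then have "dim (f ` V) = card (f ` B)"
    using assms(1) sp by (intro dim_eq_card) (metis linear_span_image span_span)
  also have "\<dots> = dim V"
    using assms(2) B by (metis card_image inj_on_subset)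
  finally show ?thesis .
qed

text \<open>An exponent of degree at most 1 is zero or a single 1, so the generators are the
  constant 1 and the coordinate functions.\<close>

lemma span_monomials_le_1:
  "span {monomial_fun \<alpha> |\<alpha>. sum \<alpha> UNIV \<le> 1} = range (\<lambda>(a, b) (x::real^'n::finite). a + b \<bullet> x)"
    (is "span ?M = ?P")
proof (rule span_unique)
  have mono0: "monomial_fun (\<lambda>_. 0) = (\<lambda>x::real^'n. 1)"
    by (simp add: monomial_fun_def fun_eq_iff)
  have mono1: "monomial_fun (\<lambda>i. if i = k then 1 else 0) = (\<lambda>x::real^'n. x $ k)" for k
    by (simp add: monomial_fun_def fun_eq_iff if_distrib[of "\<lambda>n. _ ^ n"] cong: if_cong)
  show "?M \<subseteq> ?P"
  proof clarify
    fix \<alpha> :: "'n \<Rightarrow> nat" assume le: "sum \<alpha> UNIV \<le> 1"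
    show "monomial_fun \<alpha> \<in> ?P"
    proof (cases "\<exists>k. \<alpha> k \<noteq> 0")
      case False
      then have "\<alpha> = (\<lambda>_. 0)" by auto
      then have "monomial_fun \<alpha> = (\<lambda>(a, b) x. a + b \<bullet> x) (1, 0)" by (simp add: mono0)
      then show ?thesis by blast
    next
      case True
      then obtain k where k: "\<alpha> k \<noteq> 0" by blast
      have "sum \<alpha> UNIV = \<alpha> k + sum \<alpha> (UNIV - {k})" by (simp add: sum.remove)
      with k le have "\<alpha> k = 1" "sum \<alpha> (UNIV - {k}) = 0" by linarith+
      then have "\<alpha> = (\<lambda>i. if i = k then 1 else 0)" by (auto simp: fun_eq_iff)
      then have "monomial_fun \<alpha> = (\<lambda>(a, b) x. a + b \<bullet> x) (0, axis k 1)"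
        by (simp only: mono1) (simp add: inner_axis' fun_eq_iff)
      then show ?thesis by blast
    qed
  qed
  have "linear (\<lambda>(a, b) (x::real^'n). a + b \<bullet> x)"
    by (rule linearI) (auto simp: fun_eq_iff scaleR_fun_def algebra_simps inner_add_left split: prod.splits)
  then show "subspace ?P" using linear_subspace_image subspace_UNIV by blast
  fix S :: "(real^'n \<Rightarrow> real) set" assume S: "?M \<subseteq> S" "subspace S"
  show "?P \<subseteq> S"
  proof clarify
    fix a b
    have "(\<lambda>x. 1) \<in> S" 
      unfolding mono0[symmetric] using S(1) by (rule subsetD) (intro CollectI exI[of _ "\<lambda>_. 0"], simp)
    moreover have "(\<lambda>x. x $ k) \<in> S" for k
      unfolding mono1[symmetric] using S(1)
      by (rule subsetD) (intro CollectI exI[of _ "\<lambda>i. if i = k then 1 else 0"], simp)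
    ultimately have "a *\<^sub>R (\<lambda>x. 1) + (\<Sum>k\<in>UNIV. b $ k *\<^sub>R (\<lambda>x. x $ k)) \<in> S"
      using S(2) by (intro subspace_add subspace_sum subspace_scale) auto
    also have "a *\<^sub>R (\<lambda>x. 1) + (\<Sum>k\<in>UNIV. b $ k *\<^sub>R (\<lambda>x. x $ k)) = (\<lambda>x. a + b \<bullet> x)"
    proof
      have "(\<Sum>k\<in>I. b $ k *\<^sub>R (\<lambda>x. x $ k)) x = (\<Sum>k\<in>I. b $ k * x $ k)" if "finite I" for I x
        using that by induction (auto simp: scaleR_fun_def)
      then show "(a *\<^sub>R (\<lambda>x. 1) + (\<Sum>k\<in>UNIV. b $ k *\<^sub>R (\<lambda>x. x $ k))) x = a + b \<bullet> x" for x
        by (simp add: scaleR_fun_def inner_vec_def)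
    qed
    finally show "(\<lambda>x. a + b \<bullet> x) \<in> S" .
  qed
qed

lemma polys_on_1: "polys_on 1 D = range (\<lambda>(a, b). restr D (\<lambda>x. a + b \<bullet> x))"
  unfolding polys_on_def span_monomials_le_1 by (simp add: image_image case_prod_unfold)

text \<open>Replaces the \<open>SOME\<close> by one parametrization for all integrands, so that
  later arguments use only that it is isometric.\<close>

lemma flat_integral_param:
  fixes M :: "(real^3) set"
  assumes "aff_dim M = int DIM('k::euclidean_space)"
  obtains \<phi> :: "'k::euclidean_space \<Rightarrow> real^3" where "isometric_param M \<phi>"
    "\<And>f. flat_integral TYPE('k::euclidean_space) M f = integral (\<phi> -` M) (\<lambda>y. f (\<phi> y))"
proof
  let ?\<phi> = "SOME \<phi> :: 'k \<Rightarrow> real^3. isometric_param M \<phi>"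
  show "isometric_param M ?\<phi>"
    using isometric_param_exists[OF assms] by (rule someI_ex)
  show "flat_integral TYPE('k) M f = integral (?\<phi> -` M) (\<lambda>y. f (?\<phi> y))" for f
    by (simp add: flat_integral_def Let_def)
qed

section \<open>Barycentric coordinates and their gradients\<close>

locale tetrahedron =
  fixes v :: "4 \<Rightarrow> real^3"
  assumes inj: "inj v" and indep: "\<not> affine_dependent (range v)"
begin

abbreviation lam :: "4 \<Rightarrow> real^3 \<Rightarrow> real" where "lam \<equiv> barycentric v"

text \<open>Indexing by vertex sets: \<open>UNIV\<close> gives the tetrahedron, two-element sets its
  edges, \<open>- {i}\<close> the face opposite to \<open>v i\<close>.\<close>

definition face :: "4 set \<Rightarrow> (real^3) set" where "face I = convex hull (v ` I)"

text \<open>The gradient of \<open>lam i\<close>: the adjoint of a linear functional, applied to 1,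
  is the vector that represents the functional.\<close>

definition bgrad :: "4 \<Rightarrow> real^3" where "bgrad i = adjoint (\<lambda>x. lam i x - lam i 0) 1"

text \<open>A nonzero difference of two such families would be an affine dependence of the vertices;
  \<open>inv v\<close> transports it from indices to points.\<close>

lemma coeffs_unique:
  assumes "sum c UNIV = sum c' UNIV" "(\<Sum>j\<in>UNIV. c j *\<^sub>R v j) = (\<Sum>j\<in>UNIV. c' j *\<^sub>R v j)"
  shows "c = (c' :: 4 \<Rightarrow> real)"
proof (rule ccontr)
  assume "c \<noteq> c'"
  then obtain i where i: "c i \<noteq> c' i" by auto
  let ?U = "\<lambda>x. c (inv v x) - c' (inv v x)"
  have "sum ?U (range v) = 0" "(\<Sum>x\<in>range v. ?U x *\<^sub>R x) = 0" "?U (v i) \<noteq> 0"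
    using assms i inj by (simp_all add: sum.reindex sum_subtractf scaleR_diff_left)
  then have "affine_dependent (range v)"
    by (subst affine_dependent_explicit_finite) (auto intro!: exI[of _ ?U])
  with indep show False by simp
qed

lemma affine_hull_UNIV: "affine hull (range v) = UNIV"
proof -
  have "card (range v) = 4" using inj by (simp add: card_image)
  then have "aff_dim (range v) = int DIM(real^3)"
    using aff_dim_affine_independent[OF indep] by simp
  then show ?thesis by (simp only: aff_dim_eq_full)
qed

lemma coeffs_exist: "\<exists>c. sum c UNIV = 1 \<and> (\<Sum>j\<in>UNIV. c j *\<^sub>R v j) = x"
proof -
  have "x \<in> affine hull (range v)" by (simp add: affine_hull_UNIV)
  then obtain u where "sum u (range v) = 1" "(\<Sum>y\<in>range v. u y *\<^sub>R y) = x"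
    by (auto simp: affine_hull_finite)
  then show ?thesis
    using inj by (intro exI[of _ "u \<circ> v"]) (simp add: sum.reindex)
qed

lemma lam_unique:
  assumes "sum c UNIV = 1" "(\<Sum>j\<in>UNIV. c j *\<^sub>R v j) = x"
  shows "lam i x = c i"
proof -
  have "(THE c. sum c UNIV = 1 \<and> (\<Sum>j\<in>UNIV. c j *\<^sub>R v j) = x) = c"
    using assms by (intro the_equality conjI coeffs_unique) auto
  then show ?thesis by (simp add: barycentric_def)
qed

lemma sum_lam: "(\<Sum>i\<in>UNIV. lam i x) = 1" and lam_combination: "(\<Sum>i\<in>UNIV. lam i x *\<^sub>R v i) = x"
proof -
  obtain c where c: "sum c UNIV = 1" "(\<Sum>j\<in>UNIV. c j *\<^sub>R v j) = x"
    using coeffs_exist by blast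
  then have "lam i x = c i" for i using lam_unique by blast
  with c show "(\<Sum>i\<in>UNIV. lam i x) = 1" "(\<Sum>i\<in>UNIV. lam i x *\<^sub>R v i) = x" by simp_all
qed

lemma lam_vertex: "lam i (v j) = (if i = j then 1 else 0)"
proof (rule lam_unique[of "\<lambda>i. if i = j then 1 else 0"])
  have "(\<Sum>i\<in>UNIV. (if i = j then 1 else 0) *\<^sub>R v i) = (\<Sum>i\<in>UNIV. if i = j then v i else 0)"
    by (intro sum.cong) auto
  then show "(\<Sum>i\<in>UNIV. (if i = j then 1 else 0) *\<^sub>R v i) = v j" by simp
qed simp

lemma lam_affine: "lam i x = lam i y + bgrad i \<bullet> (x - y)"
proof -
  let ?h = "\<lambda>x. lam i x - lam i 0"
  have "linear ?h"
  proof
    fix x y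
    \<comment> \<open>These coefficients sum to 1 + 1 - 1 = 1 and represent
      \<open>x + y - 0\<close>, so uniqueness identifies them. The weights \<open>r\<close> and
      \<open>1 - r\<close> do the same for scaling below.\<close>
    have "lam i (x + y) = lam i x + lam i y - lam i 0"
      by (rule lam_unique) (simp_all add: sum.distrib sum_subtractf sum_lam scaleR_add_left
          scaleR_diff_left lam_combination)
    then show "?h (x + y) = ?h x + ?h y" by simp
  next
    fix r x
    have "lam i (r *\<^sub>R x) = r * lam i x + (1 - r) * lam i 0"
      by (rule lam_unique) (simp_all add: sum.distrib sum_lam scaleR_add_left
          lam_combination flip: sum_distrib_left scaleR_scaleR scaleR_sum_right)
    then show "?h (r *\<^sub>R x) = r *\<^sub>R ?h x" by (simp add: algebra_simps)
  qed
  from adjoint_works[OF this, of _ 1] have "?h x = bgrad i \<bullet> x" for x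
    by (simp add: bgrad_def inner_commute)
  from this[of x] this[of y] show ?thesis by (simp add: inner_diff_right)
qed

lemma bgrad_vertex: "bgrad i \<bullet> (v j - v k) = lam i (v j) - lam i (v k)"
  using lam_affine[of i "v j" "v k"] by linarith

lemma sum_bgrad: "(\<Sum>i\<in>UNIV. bgrad i \<bullet> h) = 0"
proof -
  have "bgrad i \<bullet> h = lam i h - lam i 0" for i using lam_affine[of i h 0] by simp
  then show ?thesis by (simp add: sum_subtractf sum_lam)
qed

text \<open>Recovers a vector from the slopes of the barycentric coordinates along it; the slopes
  sum to 0, so the base point \<open>w\<close> is free. A vector orthogonal to every difference that
  enters with nonzero weight is then orthogonal to itself.\<close>

lemma bgrad_combination: "(\<Sum>i\<in>UNIV. (bgrad i \<bullet> h) *\<^sub>R (v i - w)) = h"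
proof -
  have "bgrad i \<bullet> h = lam i h - lam i 0" for i using lam_affine[of i h 0] by simp
  then have "(\<Sum>i\<in>UNIV. (bgrad i \<bullet> h) *\<^sub>R v i) = h"
    by (simp add: scaleR_diff_left sum_subtractf lam_combination)
  moreover have "(\<Sum>i\<in>UNIV. (bgrad i \<bullet> h) *\<^sub>R w) = 0"
    using sum_bgrad[of h] by (simp flip: scaleR_sum_left)
  ultimately show ?thesis by (simp add: scaleR_diff_right sum_subtractf)
qed

lemma continuous_on_lam [continuous_intros]:
  assumes "continuous_on S f" shows "continuous_on S (\<lambda>x. lam i (f x))"
proof -
  have "(\<lambda>x. lam i (f x)) = (\<lambda>x. lam i 0 + bgrad i \<bullet> (f x - 0))" using lam_affine by blast
  then show ?thesis using assms by (simp only:) (intro continuous_intros)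
qed

lemma affine_on_lam:
  "a + b \<bullet> x = (\<Sum>i\<in>UNIV. (a + b \<bullet> v i) * lam i x)"
proof -
  have "b \<bullet> x = (\<Sum>i\<in>UNIV. lam i x * (b \<bullet> v i))"
    using arg_cong[OF lam_combination[of x], of "inner b"] by (simp add: inner_sum_right)
  then show ?thesis
    using sum_lam[of x] by (simp add: algebra_simps sum.distrib flip: sum_distrib_left)
qed

text \<open>The coefficients are vertex values, a basis in which vanishing on faces is
  visible.\<close>

lemma polys_on_1_lam: "polys_on 1 D = range (\<lambda>d::real^4. restr D (\<lambda>x. \<Sum>i\<in>UNIV. d $ i * lam i x))"
proof (intro set_eqI iffI)
  fix p :: "real^3 \<Rightarrow> real" assume "p \<in> polys_on 1 D"
  then obtain a b where "p = restr D (\<lambda>x. a + b \<bullet> x)" unfolding polys_on_1 by auto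
  then have "p = restr D (\<lambda>x. \<Sum>i\<in>UNIV. (\<chi> i. a + b \<bullet> v i) $ i * lam i x)"
    by (simp only: vec_lambda_beta affine_on_lam[symmetric])
  then show "p \<in> range (\<lambda>d::real^4. restr D (\<lambda>x. \<Sum>i\<in>UNIV. d $ i * lam i x))" by blast
next
  fix p assume "p \<in> range (\<lambda>d::real^4. restr D (\<lambda>x. \<Sum>i\<in>UNIV. d $ i * lam i x))"
  then obtain d :: "real^4" where p: "p = restr D (\<lambda>x. \<Sum>i\<in>UNIV. d $ i * lam i x)" by blast
  have "(\<Sum>i\<in>UNIV. d $ i * lam i x) = (\<Sum>i\<in>UNIV. d $ i * lam i 0) + (\<Sum>i\<in>UNIV. d $ i *\<^sub>R bgrad i) \<bullet> x" for x
    by (subst lam_affine[of _ x 0]) (simp add: algebra_simps sum.distrib inner_sum_left)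
  then have "p = (\<lambda>(a, b). restr D (\<lambda>x. a + b \<bullet> x))
      (\<Sum>i\<in>UNIV. d $ i * lam i 0, \<Sum>i\<in>UNIV. d $ i *\<^sub>R bgrad i)"
    unfolding p prod.case by (intro arg_cong[of _ _ "restr D"] ext)
  then show "p \<in> polys_on 1 D" unfolding polys_on_1 by blast
qed

section \<open>Faces, edges and facets in barycentric coordinates\<close>

text \<open>Affine coefficients over the vertices in \<open>I\<close>, extended by 0, are the
  barycentric coordinates by uniqueness; conversely, zero coordinates may be dropped from the
  combination.\<close>

lemma mem_affine_hull_iff: "x \<in> affine hull (v ` I) \<longleftrightarrow> (\<forall>i. i \<notin> I \<longrightarrow> lam i x = 0)"
proof
  assume "x \<in> affine hull (v ` I)"
  then obtain u where u: "sum u (v ` I) = 1" "(\<Sum>y\<in>v ` I. u y *\<^sub>R y) = x"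
    by (auto simp: affine_hull_finite)
  have "lam i x = (if i \<in> I then u (v i) else 0)" for i
    using u inj by (intro lam_unique) (simp_all add: sum.reindex inj_on_subset[of _ UNIV]
        if_distrib[of "\<lambda>c. c *\<^sub>R _"] sum.If_cases cong: if_cong)
  then show "\<forall>i. i \<notin> I \<longrightarrow> lam i x = 0" by simp
next
  assume z: "\<forall>i. i \<notin> I \<longrightarrow> lam i x = 0"
  have "(\<Sum>i\<in>I. lam i x) = (\<Sum>i\<in>UNIV. lam i x)" "(\<Sum>i\<in>I. lam i x *\<^sub>R v i) = (\<Sum>i\<in>UNIV. lam i x *\<^sub>R v i)"
    using z by (auto intro!: sum.mono_neutral_left)
  then show "x \<in> affine hull (v ` I)"
    using inj sum_lam lam_combination by (subst affine_hull_finite)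
      (auto intro!: exI[of _ "\<lambda>y. lam (inv v y) x"] simp: sum.reindex inj_on_subset[of _ UNIV])
qed

lemma mem_face_iff: "x \<in> face I \<longleftrightarrow> (\<forall>i. 0 \<le> lam i x) \<and> (\<forall>i. i \<notin> I \<longrightarrow> lam i x = 0)"
proof
  assume "x \<in> face I"
  then obtain u where u: "\<forall>i\<in>I. 0 \<le> u (v i)" "sum u (v ` I) = 1" "(\<Sum>y\<in>v ` I. u y *\<^sub>R y) = x"
    by (auto simp: face_def convex_hull_finite)
  have "lam i x = (if i \<in> I then u (v i) else 0)" for i
    using u inj by (intro lam_unique) (simp_all add: sum.reindex inj_on_subset[of _ UNIV]
        if_distrib[of "\<lambda>c. c *\<^sub>R _"] sum.If_cases cong: if_cong)
  then show "(\<forall>i. 0 \<le> lam i x) \<and> (\<forall>i. i \<notin> I \<longrightarrow> lam i x = 0)" using u(1) by simp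
next
  assume z: "(\<forall>i. 0 \<le> lam i x) \<and> (\<forall>i. i \<notin> I \<longrightarrow> lam i x = 0)"
  have "(\<Sum>i\<in>I. lam i x) = (\<Sum>i\<in>UNIV. lam i x)" "(\<Sum>i\<in>I. lam i x *\<^sub>R v i) = (\<Sum>i\<in>UNIV. lam i x *\<^sub>R v i)"
    using z by (auto intro!: sum.mono_neutral_left)
  then show "x \<in> face I"
    unfolding face_def using inj z sum_lam lam_combination by (subst convex_hull_finite)
      (auto intro!: exI[of _ "\<lambda>y. lam (inv v y) x"] simp: sum.reindex inj_on_subset[of _ UNIV])
qed

lemma face_UNIV: "face UNIV = convex hull (range v)"
  by (simp add: face_def)

lemma vertex_mem_face_iff: "v i \<in> face I \<longleftrightarrow> i \<in> I"
  by (auto simp: mem_face_iff lam_vertex)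

lemma inj_face: "inj face"
  by (rule injI) (metis vertex_mem_face_iff set_eqI)

lemma aff_dim_face: "aff_dim (face I) = int (card I) - 1"
proof -
  have "card (v ` I) = card I" using inj by (simp add: card_image inj_on_subset)
  moreover have "\<not> affine_dependent (v ` I)" by (intro affine_independent_subset[OF indep] image_mono) simp
  ultimately show ?thesis
    using aff_dim_affine_independent[of "v ` I"] by (simp add: face_def aff_dim_convex_hull)
qed

lemma affine_hull_face: "affine hull (face I) = affine hull (v ` I)"
  by (simp add: face_def affine_hull_convex_hull)

text \<open>The faces of a simplex are the hulls of subsets of its vertices, and dimension 1 means
  two vertices.\<close>

lemma edges: "{e. e edge_of face UNIV} = face ` {I. card I = 2}"
proof -
  have "e face_of face UNIV \<longleftrightarrow> (\<exists>I. e = face I)" for e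
    unfolding face_def face_of_convex_hull_affine_independent[OF indep]
    by (metis subset_image_iff subset_UNIV)
  moreover have "aff_dim (face I) = 1 \<longleftrightarrow> card I = 2" for I by (simp add: aff_dim_face)
  ultimately show ?thesis by (auto simp: edge_of_def)
qed

lemma facets: "{F. F facet_of face UNIV} = (\<lambda>i. face (- {i})) ` UNIV"
proof -
  have "v ` (- {i}) = range v - {v i}" for i by (simp add: image_set_diff[OF inj] Compl_eq_Diff_UNIV)
  moreover have "face (- {i}) \<noteq> {}" for i
    using aff_dim_face[of "- {i}"] by (auto simp: Compl_eq_Diff_UNIV card_Diff_singleton)
  ultimately show ?thesis
    unfolding face_def facet_of_convex_hull_affine_independent[OF indep] by auto
qed

text \<open>Vertex values off \<open>I\<close> can be set to 0 without changing the image, because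
  those \<open>lam i\<close> vanish on the face; the remaining ones are recovered by evaluation at
  the vertices in \<open>I\<close>.\<close>

lemma dim_polys_on_face: "dim (polys_on 1 (face I)) = card I"
proof -
  have *: "(\<Sum>i\<in>UNIV. d $ i * lam i (v j)) = d $ j" for d :: "real^4" and j
  proof -
    have "(\<Sum>i\<in>UNIV. d $ i * lam i (v j)) = (\<Sum>i\<in>UNIV. if i = j then d $ i else 0)"
      by (intro sum.cong) (auto simp: lam_vertex)
    then show ?thesis by simp
  qed
  let ?f = "\<lambda>d::real^4. restr (face I) (\<lambda>x. \<Sum>i\<in>UNIV. d $ i * lam i x)"
  let ?V = "{d::real^4. \<forall>i. i \<notin> I \<longrightarrow> d $ i = 0}"
  have lin: "linear ?f"
    by (rule linearI) (auto simp: fun_eq_iff restr_def scaleR_fun_def algebra_simps sum.distrib sum_distrib_left)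
  have vert: "?f d (v i) = (if i \<in> I then d $ i else 0)" for d i
    by (simp add: restr_def vertex_mem_face_iff *)
  have "inj_on ?f ?V"
  proof (rule inj_onI)
    fix d d' assume "d \<in> ?V" "d' \<in> ?V" "?f d = ?f d'"
    then have "d $ i = d' $ i" for i using vert[of d i] vert[of d' i] by (cases "i \<in> I") auto
    then show "d = d'" by (simp add: vec_eq_iff)
  qed
  moreover have "subspace ?V" by (auto simp: subspace_def)
  moreover have "range ?f = ?f ` ?V"
  proof -
    have "?f d = ?f (\<chi> i. if i \<in> I then d $ i else 0)" for d
      by (auto simp: fun_eq_iff restr_def mem_face_iff intro!: sum.cong)
    moreover have "(\<chi> i. if i \<in> I then d $ i else 0) \<in> ?V" for d :: "real^4" by simp
    ultimately show ?thesis by blast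
  qed
  ultimately have "dim (polys_on 1 (face I)) = dim ?V"
    using dim_linear_image_inj[OF lin] unfolding polys_on_1_lam by simp
  also have "\<dots> = card I"
    by (metis (mono_tags, lifting) dim_substandard_cart dim_vec_eq)
  finally show ?thesis .
qed


section \<open>Parametrization of the shape functions by vertex values\<close>

definition lin_field :: "real^3^4 \<Rightarrow> real^3 \<Rightarrow> real^3" where
  "lin_field c = restr (face UNIV) (\<lambda>x. \<Sum>i\<in>UNIV. lam i x *\<^sub>R c $ i)"

text \<open>The product rule written out for the gradient of \<open>bubble v\<close> times the
  affine function with vertex values \<open>d\<close>.\<close>

definition bubble_field :: "real^4 \<Rightarrow> real^3 \<Rightarrow> real^3" where
  "bubble_field d = restr (face UNIV) (\<lambda>x.
     bubble v x *\<^sub>R (\<Sum>i\<in>UNIV. d $ i *\<^sub>R bgrad i) +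
     (\<Sum>i\<in>UNIV. d $ i * lam i x) *\<^sub>R (\<Sum>i\<in>UNIV. (\<Prod>j\<in>-{i}. lam j x) *\<^sub>R bgrad i))"

lemma linear_lin_field: "linear lin_field"
  by (rule linearI) (auto simp: lin_field_def fun_eq_iff restr_def scaleR_fun_def scaleR_add_right
      sum.distrib scaleR_sum_right mult.commute)

lemma linear_bubble_field: "linear bubble_field"
proof
  show "bubble_field (d + d') = bubble_field d + bubble_field d'" for d d'
    by (auto simp: bubble_field_def fun_eq_iff restr_def algebra_simps sum.distrib)
  have "(\<Sum>i\<in>UNIV. (r * d $ i) *\<^sub>R bgrad i) = r *\<^sub>R (\<Sum>i\<in>UNIV. d $ i *\<^sub>R bgrad i)"
    "(\<Sum>i\<in>UNIV. r * d $ i * lam i x) = r * (\<Sum>i\<in>UNIV. d $ i * lam i x)" for r d x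
    by (simp_all add: scaleR_sum_right sum_distrib_left mult.assoc)
  then show "bubble_field (r *\<^sub>R d) = r *\<^sub>R bubble_field d" for r d
    by (simp add: bubble_field_def fun_eq_iff restr_def scaleR_fun_def scaleR_add_right mult.commute)
qed

lemma vpolys_on_1: "vpolys_on 1 (face UNIV) = range lin_field"
proof (intro set_eqI iffI)
  fix u assume "u \<in> vpolys_on 1 (face UNIV)"
  then have "\<forall>k. \<exists>d::real^4. (\<lambda>x. u x $ k) = restr (face UNIV) (\<lambda>x. \<Sum>i\<in>UNIV. d $ i * lam i x)"
    unfolding vpolys_on_def polys_on_1_lam by blast
  then obtain d :: "3 \<Rightarrow> real^4" where
    d: "(\<lambda>x. u x $ k) = restr (face UNIV) (\<lambda>x. \<Sum>i\<in>UNIV. d k $ i * lam i x)" for k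
    unfolding choice_iff by blast
  have "u = lin_field (\<chi> i k. d k $ i)"
  proof (intro ext vec_eq_iff[THEN iffD2] allI)
    show "u x $ k = lin_field (\<chi> i k. d k $ i) x $ k" for x k
      using fun_cong[OF d[of k], of x] by (simp add: lin_field_def restr_def mult.commute)
  qed
  then show "u \<in> range lin_field" by blast
next
  fix u assume "u \<in> range lin_field"
  then obtain c where u: "u = lin_field c" by blast
  have "(\<lambda>x. u x $ k) = restr (face UNIV) (\<lambda>x. \<Sum>i\<in>UNIV. (\<chi> i. c $ i $ k) $ i * lam i x)" for k
    by (simp add: u lin_field_def restr_def fun_eq_iff mult.commute)
  then show "u \<in> vpolys_on 1 (face UNIV)"
    unfolding vpolys_on_def polys_on_1_lam by blast
qed

lemma lam_has_derivative: "(lam i has_derivative (\<lambda>h. bgrad i \<bullet> h)) (at x within S)"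
proof -
  have "lam i = (\<lambda>x. lam i 0 + bgrad i \<bullet> (x - 0))" using lam_affine by blast
  then show ?thesis by (rule ssubst) (auto intro!: derivative_eq_intros)
qed

lemma grad_on_bubble:
  "grad_on (face UNIV) (\<lambda>x. bubble v x * restr (face UNIV) (\<lambda>x. \<Sum>i\<in>UNIV. d $ i * lam i x) x) = bubble_field d"
proof
  fix x
  let ?T = "face UNIV"
  let ?p = "\<lambda>x. \<Sum>i\<in>UNIV. d $ i * lam i x"
  let ?f = "\<lambda>x. bubble v x * restr ?T ?p x"
  have eq: "bubble v = (\<lambda>x. \<Prod>i\<in>UNIV. lam i x)" by (simp add: bubble_def fun_eq_iff)
  show "grad_on ?T ?f x = bubble_field d x"
  proof (cases "x \<in> ?T")
    case True
    have "((\<lambda>x. bubble v x * ?p x) has_derivative (\<lambda>h. bubble_field d x \<bullet> h)) (at x within ?T)"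
    proof -
      have "(bubble v has_derivative
          (\<lambda>h. \<Sum>i\<in>UNIV. (bgrad i \<bullet> h) * (\<Prod>j\<in>UNIV - {i}. lam j x))) (at x within ?T)"
        unfolding eq by (intro has_derivative_prod lam_has_derivative)
      moreover have "(?p has_derivative (\<lambda>h. \<Sum>i\<in>UNIV. d $ i * (bgrad i \<bullet> h))) (at x within ?T)"
        by (intro has_derivative_sum has_derivative_mult_right lam_has_derivative)
      ultimately have "((\<lambda>x. bubble v x * ?p x) has_derivative
          (\<lambda>h. bubble v x * (\<Sum>i\<in>UNIV. d $ i * (bgrad i \<bullet> h)) +
            (\<Sum>i\<in>UNIV. (bgrad i \<bullet> h) * (\<Prod>j\<in>UNIV - {i}. lam j x)) * ?p x)) (at x within ?T)"
        by (rule has_derivative_mult)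
      then show ?thesis
        by (rule has_derivative_eq_rhs)
          (simp add: fun_eq_iff bubble_field_def restr_def True inner_add_left inner_sum_left
            Compl_eq_Diff_UNIV mult.commute)
    qed
    \<comment> \<open>A derivative within \<open>?T\<close> depends only on values in
      \<open>?T\<close>, where the restriction agrees with \<open>?p\<close>.\<close>
    then have der: "(?f has_derivative (\<lambda>h. bubble_field d x \<bullet> h)) (at x within ?T)"
      by (rule has_derivative_transform_within[OF _ zero_less_one True]) (simp add: restr_def)
    then have "(?f has_derivative frechet_derivative ?f (at x within ?T)) (at x within ?T)"
      using frechet_derivative_works differentiable_def by blast
    \<comment> \<open>Uniqueness on the convex, full-dimensional \<open>?T\<close> identifies the
      chosen derivative, also at boundary points.\<close>
    then have "frechet_derivative ?f (at x within ?T) = (\<lambda>h. bubble_field d x \<bullet> h)"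
      using der True by (intro has_derivative_unique_within_convex[where f = ?f and S = ?T])
        (auto simp: face_UNIV affine_hull_convex_hull affine_hull_UNIV)
    then show ?thesis
      using True by (simp add: grad_on_def restr_def vec_eq_iff inner_axis)
  qed (simp add: grad_on_def bubble_field_def restr_def)
qed

lemma grad_bubble_space: "grad_bubble_space v = range bubble_field"
  unfolding grad_bubble_space_def Let_def polys_on_1_lam image_image
  by (simp only: face_UNIV[symmetric] grad_on_bubble)

lemma bubble_field_edge:
  assumes "lam i x = 0" "lam j x = 0" "i \<noteq> j"
  shows "bubble_field d x = 0"
proof -
  have "(\<Prod>m\<in>-{k}. lam m x) = 0" for k
    using assms by (cases "k = i") (auto intro!: prod_zero)
  then have "(\<Sum>i\<in>UNIV. (\<Prod>j\<in>-{i}. lam j x) *\<^sub>R bgrad i) = 0"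
    by (intro sum.neutral ballI) (simp only: scaleR_zero_left)
  moreover have "bubble v x = 0" using assms by (auto simp: bubble_def intro!: prod_zero)
  ultimately show ?thesis by (simp add: bubble_field_def restr_def)
qed

lemma bubble_field_facet:
  assumes "x \<in> face (-{i})"
  shows "bubble_field d x = ((\<Sum>j\<in>UNIV. d $ j * lam j x) * (\<Prod>j\<in>-{i}. lam j x)) *\<^sub>R bgrad i"
proof -
  have i: "lam i x = 0" and T: "x \<in> face UNIV" using assms by (auto simp: mem_face_iff)
  \<comment> \<open>Every summand other than \<open>k = i\<close> still contains the factor
    \<open>lam i x = 0\<close>.\<close>
  have "(\<Sum>k\<in>UNIV. (\<Prod>m\<in>-{k}. lam m x) *\<^sub>R bgrad k) = (\<Sum>k\<in>{i}. (\<Prod>m\<in>-{k}. lam m x) *\<^sub>R bgrad k)"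
    using i by (intro sum.mono_neutral_right) (auto intro!: prod_zero)
  moreover have "bubble v x = 0" using i by (auto simp: bubble_def intro!: prod_zero)
  ultimately show ?thesis using T by (simp add: bubble_field_def restr_def)
qed

section \<open>Integrals over faces in isometric coordinates\<close>

text \<open>The range of \<open>\<phi>\<close> is the affine hull of the face, where the coordinates
  off \<open>I\<close> vanish; so in the parameter domain the face is cut out by inequalities
  alone.\<close>

lemma isometric_param_face:
  assumes "isometric_param (face I) \<phi>"
  shows "\<phi> -` face I = {y. \<forall>i. 0 \<le> lam i (\<phi> y)}"
    and "i \<notin> I \<Longrightarrow> lam i (\<phi> y) = 0"
    and "continuous_on S \<phi>"
    and "compact (\<phi> -` face I)"
proof -
  have iso: "dist (\<phi> x) (\<phi> y) = dist x y" for x y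
    using assms by (simp add: isometric_param_def)
  show out: "lam i (\<phi> y) = 0" if "i \<notin> I" for i y
    using assms that mem_affine_hull_iff[of "\<phi> y" I] affine_hull_face
    by (auto simp: isometric_param_def)
  then show "\<phi> -` face I = {y. \<forall>i. 0 \<le> lam i (\<phi> y)}"
    by (auto simp: mem_face_iff)
  show cont: "continuous_on S \<phi>" for S
    unfolding continuous_on_iff iso by blast
  have "compact (face I)" by (simp add: face_def finite_imp_compact_convex_hull)
  then have "closed (\<phi> -` face I)"
    by (intro closed_vimage cont) (auto intro: compact_imp_closed)
  moreover have "bounded (\<phi> -` face I)"
  proof -
    have "bounded (face I)" using \<open>compact (face I)\<close> by (rule compact_imp_bounded)
    then obtain e where "\<forall>x\<in>face I. dist (\<phi> 0) x \<le> e" using bounded_any_center by blast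
    then have "\<forall>y\<in>\<phi> -` face I. dist 0 y \<le> e" by (metis iso vimageE)
    then show ?thesis unfolding bounded_def by blast
  qed
  ultimately show "compact (\<phi> -` face I)" by (simp add: compact_eq_bounded_closed)
qed

text \<open>Positive coordinates on \<open>I\<close> put the test point in the relative interior of
  the face, so its parameter is an interior point of the domain of integration.\<close>

lemma face_integral_0_imp_0:
  fixes \<phi> :: "'k::euclidean_space \<Rightarrow> real^3" and f :: "real^3 \<Rightarrow> real"
  assumes param: "isometric_param (face I) \<phi>"
    and f: "continuous_on UNIV f" "\<And>x. x \<in> face I \<Longrightarrow> 0 \<le> f x"
    and int: "integral (\<phi> -` face I) (\<lambda>y. f (\<phi> y)) = 0"
    and c: "sum c UNIV = 1" "\<And>i. i \<in> I \<Longrightarrow> 0 < c i" "\<And>i. i \<notin> I \<Longrightarrow> c i = 0"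
  shows "f (\<Sum>i\<in>UNIV. c i *\<^sub>R v i) = 0"
proof -
  let ?x = "\<Sum>i\<in>UNIV. c i *\<^sub>R v i"
  let ?O = "\<Inter>i\<in>I. {y. 0 < lam i (\<phi> y)}"
  have lam: "lam i ?x = c i" for i by (rule lam_unique[OF c(1) refl])
  then have "?x \<in> affine hull (face I)" by (simp add: affine_hull_face mem_affine_hull_iff c)
  then obtain y where y: "\<phi> y = ?x" using param unfolding isometric_param_def by (metis rangeE)
  note cont = isometric_param_face(3)[OF param]
  have "f (\<phi> y) = 0"
  proof (rule continuous_nonneg_integral_0_imp_0[where f = "\<lambda>y. f (\<phi> y)" and K = "\<phi> -` face I" and O' = ?O])
    show "open ?O"
      by (intro open_INT ballI open_Collect_less continuous_intros cont) auto
    show "?O \<subseteq> \<phi> -` face I"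
      unfolding isometric_param_face(1)[OF param] using isometric_param_face(2)[OF param]
      by (force intro: less_imp_le)
    show "continuous_on (\<phi> -` face I) (\<lambda>y. f (\<phi> y))"
      by (rule continuous_on_compose2[OF f(1) cont]) simp
  qed (use isometric_param_face(4)[OF param] f int y lam c in auto)
  then show ?thesis by (simp add: y)
qed

text \<open>The affine map of the parameter domain that exchanges the vertices \<open>v j\<close> and \<open>v k\<close>
  is an involution, hence preserves Lebesgue measure.\<close>

lemma face_integral_symmetric:
  fixes \<phi> :: "real^'n::{finite,wellorder} \<Rightarrow> real^3"
  assumes param: "isometric_param (face I) \<phi>" and jk: "j \<in> I" "k \<in> I"
  shows "integral (\<phi> -` face I) (\<lambda>y. lam j (\<phi> y) * (\<Prod>m\<in>I. lam m (\<phi> y))) =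
    integral (\<phi> -` face I) (\<lambda>y. lam k (\<phi> y) * (\<Prod>m\<in>I. lam m (\<phi> y)))"
proof (cases "j = k")
  case False
  define h where "h x = \<phi> x - \<phi> 0" for x
  have h: "linear h" unfolding h_def
    using param by (intro isometry_affine) (simp add: isometric_param_def)
  have hd: "h x - h y = \<phi> x - \<phi> y" for x y by (simp add: h_def)
  have "v j \<in> range \<phi>" "v k \<in> range \<phi>"
    using param jk by (simp_all add: isometric_param_def affine_hull_face hull_inc)
  then obtain a b where a: "\<phi> a = v j" and b: "\<phi> b = v k" by (metis rangeE)
  \<comment> \<open>Moving along \<open>b - a\<close>, which corresponds to
    \<open>v k - v j\<close>, lowers coordinate \<open>j\<close> and raises coordinate
    \<open>k\<close> equally; the amount \<open>lam j - lam k\<close> makes them trade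
    values.\<close>
  define A where "A y = y + (lam j (\<phi> y) - lam k (\<phi> y)) *\<^sub>R (b - a)" for y
  define L where "L z = z + (bgrad j \<bullet> h z - bgrad k \<bullet> h z) *\<^sub>R (b - a)" for z
  have phiA: "\<phi> (A y) = \<phi> y + (lam j (\<phi> y) - lam k (\<phi> y)) *\<^sub>R (v k - v j)" for y
  proof -
    have "h (A y) = h y + (lam j (\<phi> y) - lam k (\<phi> y)) *\<^sub>R (h b - h a)"
      by (simp add: A_def linear_add[OF h] linear_diff[OF h] linear_scale[OF h])
    then show ?thesis unfolding hd a b by (simp add: h_def)
  qed
  have lamA: "lam m (\<phi> (A y)) = lam (Transposition.transpose j k m) (\<phi> y)" for m y
  proof -
    have "lam m (\<phi> (A y)) = lam m (\<phi> y) + (lam j (\<phi> y) - lam k (\<phi> y)) * (lam m (v k) - lam m (v j))"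
      unfolding phiA by (subst lam_affine[of _ _ "\<phi> y"]) (simp add: bgrad_vertex)
    then show ?thesis
      using False by (auto simp: lam_vertex Transposition.transpose_def)
  qed
  let ?f = "\<lambda>y. lam k (\<phi> y) * (\<Prod>m\<in>I. lam m (\<phi> y))"
  have "integral (\<phi> -` face I) (\<lambda>y. ?f (A y)) = integral (\<phi> -` face I) ?f"
  proof (rule integral_affine_involution)
    show "compact (\<phi> -` face I)" by (rule isometric_param_face[OF param])
    show "continuous_on (\<phi> -` face I) ?f"
      by (intro continuous_intros isometric_param_face(3)[OF param])
    show "linear L"
      by (rule linearI) (simp_all add: L_def linear_add[OF h] linear_scale[OF h] algebra_simps inner_add_right)
    show "A x - A y = L (x - y)" for x y
    proof -
      have "lam m (\<phi> x) - lam m (\<phi> y) = bgrad m \<bullet> h (x - y)" for m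
        using lam_affine[of m "\<phi> x" "\<phi> y"] by (simp add: linear_diff[OF h] hd)
      then show ?thesis by (simp add: A_def L_def algebra_simps)
    qed
    \<comment> \<open>After one application the difference of the two coordinates has changed sign,
      so the second displacement cancels the first.\<close>
    show "A (A y) = y" for y
      using lamA[of j y] lamA[of k y] by (simp add: A_def[of "A y"]) (simp add: A_def algebra_simps)
    show "A ` (\<phi> -` face I) \<subseteq> \<phi> -` face I"
      unfolding isometric_param_face(1)[OF param] by (auto simp: lamA)
  qed
  \<comment> \<open>The transposition permutes \<open>I\<close>, so the product is invariant; only
    the extra factor \<open>lam k\<close> turns into \<open>lam j\<close>.\<close>
  moreover have "(\<Prod>m\<in>I. lam m (\<phi> (A y))) = (\<Prod>m\<in>I. lam m (\<phi> y))" for y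
    unfolding lamA using jk
    by (intro prod.reindex_bij_betw[where h = "Transposition.transpose j k"]) (simp add: bij_betw_transpose_iff)
  ultimately show ?thesis by (simp add: lamA)
qed simp


section \<open>Vanishing degrees of freedom force vanishing coefficients\<close>

text \<open>Between points of the edge only the coordinates \<open>i\<close> and \<open>j\<close>
  change, so \<open>bgrad_combination\<close> with base point \<open>v j\<close> leaves a multiple
  of \<open>v i - v j\<close>.\<close>

lemma unit_tangent_edge:
  assumes "unit_tangent (face {i, j}) w"
  obtains s where "w = s *\<^sub>R (v i - v j)" "s \<noteq> 0"
proof -
  have "x - y \<in> span {v i - v j}" if "x \<in> face {i, j}" "y \<in> face {i, j}" for x y
  proof -
    have z: "bgrad m \<bullet> (x - y) = 0" if "m \<notin> {i, j}" for m
      using that \<open>x \<in> _\<close> \<open>y \<in> _\<close> lam_affine[of m x y] by (simp add: mem_face_iff)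
    have "x - y = (\<Sum>m\<in>UNIV. (bgrad m \<bullet> (x - y)) *\<^sub>R (v m - v j))"
      by (rule bgrad_combination[symmetric])
    also have "\<dots> = (\<Sum>m\<in>{i}. (bgrad m \<bullet> (x - y)) *\<^sub>R (v m - v j))"
      using z by (intro sum.mono_neutral_right) auto
    finally show ?thesis by (simp add: span_singleton)
  qed
  then have "span {x - y |x y. x \<in> face {i, j} \<and> y \<in> face {i, j}} \<subseteq> span {v i - v j}"
    by (intro span_minimal) auto
  then obtain s where "w = s *\<^sub>R (v i - v j)"
    using assms by (auto simp: unit_tangent_def span_singleton)
  moreover have "s \<noteq> 0" using assms calculation by (auto simp: unit_tangent_def)
  ultimately show thesis by (rule that)
qed

text \<open>Otherwise \<open>bgrad_combination\<close>, with a base vertex on the face, would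
  express the normal by differences of vertices of the face, all orthogonal to it.\<close>

lemma unit_normal_facet:
  assumes "unit_normal (face (-{i})) w"
  shows "bgrad i \<bullet> w \<noteq> 0"
proof
  assume 0: "bgrad i \<bullet> w = 0"
  obtain k where k: "k \<noteq> i" by (metis one_neq_zero)
  have "w \<bullet> (v j - v k) = 0" if "j \<noteq> i" for j
    using assms that k by (simp add: unit_normal_def vertex_mem_face_iff)
  then have "w \<bullet> (\<Sum>j\<in>UNIV. (bgrad j \<bullet> w) *\<^sub>R (v j - v k)) = 0"
    unfolding inner_sum_right using 0 by (intro sum.neutral) (metis inner_scaleR_right mult_eq_0_iff)
  then have "w \<bullet> w = 0" by (simp only: bgrad_combination)
  with assms show False by (auto simp: unit_normal_def)
qed

lemma edge_moments_eq_0_imp_coeffs_0: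
  assumes t: "\<And>I. card I = 2 \<Longrightarrow> unit_tangent (face I) (t (face I))"
    and dof: "\<And>I q. card I = 2 \<Longrightarrow> q \<in> polys_on 1 (face I) \<Longrightarrow>
      line_integral (face I) (\<lambda>x. ((lin_field c + bubble_field d) x \<bullet> t (face I)) * q x) = 0"
  shows "c = 0"
proof -
  have edge: "c $ i \<bullet> (v i - v j) = 0" if ij: "i \<noteq> j" for i j
  proof -
    let ?I = "{i, j}"
    define w where "w = t (face ?I)"
    \<comment> \<open>The tangential component of the linear part. Taken as test function
      \<open>q\<close>, it makes the moment an integral of a square.\<close>
    define f where "f x = (\<Sum>m\<in>UNIV. (c $ m \<bullet> w) * lam m x)" for x
    define q where "q = restr (face ?I) f"
    have card: "card ?I = 2" using ij by simp
    then have "aff_dim (face ?I) = int DIM(real)" by (simp add: aff_dim_face)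
    then obtain \<phi> :: "real \<Rightarrow> real^3" where param: "isometric_param (face ?I) \<phi>"
      and int: "\<And>f. line_integral (face ?I) f = integral (\<phi> -` face ?I) (\<lambda>y. f (\<phi> y))"
      using flat_integral_param by blast
    have "q = restr (face ?I) (\<lambda>x. \<Sum>m\<in>UNIV. (\<chi> m. c $ m \<bullet> w) $ m * lam m x)"
      by (simp add: q_def f_def restr_def fun_eq_iff)
    then have "q \<in> polys_on 1 (face ?I)" unfolding polys_on_1_lam by blast
    from dof[OF card this] have "integral (\<phi> -` face ?I)
        (\<lambda>y. ((lin_field c + bubble_field d) (\<phi> y) \<bullet> w) * q (\<phi> y)) = 0"
      by (simp only: int w_def)
    also have "integral (\<phi> -` face ?I) (\<lambda>y. ((lin_field c + bubble_field d) (\<phi> y) \<bullet> w) * q (\<phi> y)) =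
        integral (\<phi> -` face ?I) (\<lambda>y. (f (\<phi> y))\<^sup>2)"
    proof (rule integral_cong)
      fix y assume "y \<in> \<phi> -` face ?I"
      then have y: "\<phi> y \<in> face ?I" by simp
      \<comment> \<open>The two vertices off the edge give two vanishing coordinates, so the bubble
        part drops out.\<close>
      obtain k l where kl: "k \<notin> ?I" "l \<notin> ?I" "k \<noteq> l"
      proof -
        have "card (- ?I) = 2" using ij by (simp add: Compl_eq_Diff_UNIV card_Diff_subset)
        then show thesis using that by (auto simp: card_2_iff)
      qed
      then have "bubble_field d (\<phi> y) = 0"
        using y by (intro bubble_field_edge[of k _ l]) (auto simp: mem_face_iff)
      then show "((lin_field c + bubble_field d) (\<phi> y) \<bullet> w) * q (\<phi> y) = (f (\<phi> y))\<^sup>2"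
        using y by (simp add: q_def restr_def lin_field_def f_def mem_face_iff inner_sum_left
            power2_eq_square mult.commute)
    qed
    finally have 0: "integral (\<phi> -` face ?I) (\<lambda>y. (f (\<phi> y))\<^sup>2) = 0" .
    have comb: "s * (c $ i \<bullet> w) + (1 - s) * (c $ j \<bullet> w) = 0" if s: "0 < s" "s < 1" for s
    proof -
      let ?a = "\<lambda>m. if m = i then s else if m = j then 1 - s else 0"
      have red: "(\<Sum>m\<in>UNIV. g m * ?a m) = g i * s + g j * (1 - s)" for g :: "4 \<Rightarrow> real"
      proof -
        have "(\<Sum>m\<in>UNIV. g m * ?a m) = (\<Sum>m\<in>?I. g m * ?a m)"
          by (intro sum.mono_neutral_right) auto
        then show ?thesis using ij by simp
      qed
      from red[of "\<lambda>_. 1"] have sum1: "sum ?a UNIV = 1" by simp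
      have "continuous_on UNIV f" unfolding f_def by (intro continuous_intros)
      then have "(f (\<Sum>m\<in>UNIV. ?a m *\<^sub>R v m))\<^sup>2 = 0"
        using s ij by (intro face_integral_0_imp_0[OF param _ _ 0 sum1]) (auto intro!: continuous_intros)
      then have "f (\<Sum>m\<in>UNIV. ?a m *\<^sub>R v m) = 0" by simp
      also have "f (\<Sum>m\<in>UNIV. ?a m *\<^sub>R v m) = (\<Sum>m\<in>UNIV. (c $ m \<bullet> w) * ?a m)"
        unfolding f_def using lam_unique[OF sum1 refl] by simp
      finally show ?thesis unfolding red by (simp add: mult.commute)
    qed
    \<comment> \<open>The values at two interior points of the edge determine the affine function,
      so its endpoint value is 0 as well.\<close>
    have "c $ i \<bullet> w = 0" using comb[of "1/3"] comb[of "2/3"] by simp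
    moreover obtain s where "w = s *\<^sub>R (v i - v j)" "s \<noteq> 0"
      using t[OF card] unit_tangent_edge unfolding w_def by blast
    ultimately show ?thesis by simp
  qed
  have "c $ i = 0" for i
  proof -
    have "c $ i \<bullet> (v m - v i) = 0" for m
      using edge[of i m] by (cases "m = i") (auto simp: inner_diff_right)
    \<comment> \<open>The sum equals \<open>c $ i\<close> by \<open>bgrad_combination\<close>, so
      \<open>c $ i\<close> is orthogonal to itself.\<close>
    then have "c $ i \<bullet> (\<Sum>m\<in>UNIV. (bgrad m \<bullet> c $ i) *\<^sub>R (v m - v i)) = 0"
      by (simp add: inner_sum_right)
    then show ?thesis by (simp add: bgrad_combination)
  qed
  then show ?thesis by (simp add: vec_eq_iff)
qed

text \<open>For use once the linear part is known to be zero, so that only the bubble field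
  contributes to the fluxes.\<close>

lemma facet_fluxes_eq_0_imp_coeffs_0:
  assumes n: "\<And>i. unit_normal (face (-{i})) (n (face (-{i})))"
    and dof: "\<And>i. surface_integral (face (-{i})) (\<lambda>x. bubble_field d x \<bullet> n (face (-{i}))) = 0"
  shows "d = 0"
proof -
  have sum0: "(\<Sum>m\<in>-{i}. d $ m) = 0" for i
  proof -
    let ?I = "- {i}"
    define w where "w = n (face ?I)"
    have card: "card ?I = 3" by (simp add: Compl_eq_Diff_UNIV card_Diff_singleton)
    then have "aff_dim (face ?I) = int DIM(real^2)" by (simp add: aff_dim_face)
    then obtain \<phi> :: "real^2 \<Rightarrow> real^3" where param: "isometric_param (face ?I) \<phi>"
      and int: "\<And>f. surface_integral (face ?I) f = integral (\<phi> -` face ?I) (\<lambda>y. f (\<phi> y))"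
      using flat_integral_param by blast
    obtain k where k: "k \<in> ?I"
      using card by (metis card.empty ex_in_conv zero_neq_numeral)
    let ?K = "\<phi> -` face ?I"
    \<comment> \<open>Up to the constant \<open>bgrad i \<bullet> w\<close>, the normal component on
      the face is the combination of the \<open>g m\<close> with coefficients
      \<open>d $ m\<close>.\<close>
    define g where "g m x = lam m x * (\<Prod>j\<in>?I. lam j x)" for m x
    have cont: "continuous_on S (g m)" for S m unfolding g_def by (intro continuous_intros)
    have integrable: "(\<lambda>y. g m (\<phi> y)) integrable_on ?K" for m
      unfolding g_def
      by (intro set_lebesgue_integral_eq_integral(1) absolutely_integrable_continuous_compact
          isometric_param_face[OF param] continuous_intros)
    have "0 = integral ?K (\<lambda>y. bubble_field d (\<phi> y) \<bullet> w)"
      using dof[of i] by (simp only: int w_def)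
    also have "\<dots> = integral ?K (\<lambda>y. (bgrad i \<bullet> w) * (\<Sum>m\<in>?I. d $ m * g m (\<phi> y)))"
    proof (rule integral_cong)
      fix y assume "y \<in> ?K"
      then have y: "\<phi> y \<in> face ?I" by simp
      then have "(\<Sum>m\<in>UNIV. d $ m * lam m (\<phi> y)) = (\<Sum>m\<in>?I. d $ m * lam m (\<phi> y))"
        by (intro sum.mono_neutral_right) (auto simp: mem_face_iff)
      then show "bubble_field d (\<phi> y) \<bullet> w = (bgrad i \<bullet> w) * (\<Sum>m\<in>?I. d $ m * g m (\<phi> y))"
        by (simp add: bubble_field_facet[OF y] g_def sum_distrib_left sum_distrib_right ac_simps)
    qed
    also have "\<dots> = (bgrad i \<bullet> w) * (\<Sum>m\<in>?I. d $ m * integral ?K (\<lambda>y. g m (\<phi> y)))"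
      using integrable by (simp add: integral_sum integrable_on_mult_right)
    finally have "(\<Sum>m\<in>?I. d $ m * integral ?K (\<lambda>y. g m (\<phi> y))) = 0"
      using unit_normal_facet[OF n, of i] by (simp add: w_def)
    moreover have "integral ?K (\<lambda>y. g m (\<phi> y)) = integral ?K (\<lambda>y. g k (\<phi> y))" if "m \<in> ?I" for m
      unfolding g_def using face_integral_symmetric[OF param that k] .
    ultimately have "(\<Sum>m\<in>?I. d $ m) * integral ?K (\<lambda>y. g k (\<phi> y)) = 0"
      by (simp add: sum_distrib_right)
    moreover have "integral ?K (\<lambda>y. g k (\<phi> y)) \<noteq> 0"
    proof
      assume 0: "integral ?K (\<lambda>y. g k (\<phi> y)) = 0"
      \<comment> \<open>The centroid of the face, where \<open>g k\<close> has the positive value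
        1/81.\<close>
      let ?a = "\<lambda>m. if m = i then 0 else 1/3 :: real"
      have "sum ?a UNIV = sum ?a ?I" by (intro sum.mono_neutral_right) auto
      also have "\<dots> = (\<Sum>m\<in>?I. 1/3)" by (intro sum.cong) auto
      finally have sum1: "sum ?a UNIV = 1" using card by simp
      have "g k (\<Sum>m\<in>UNIV. ?a m *\<^sub>R v m) = 0"
        by (rule face_integral_0_imp_0[OF param cont _ 0 sum1])
          (auto simp: g_def mem_face_iff intro!: mult_nonneg_nonneg prod_nonneg)
      moreover have "g k (\<Sum>m\<in>UNIV. ?a m *\<^sub>R v m) = 1/3 * (\<Prod>m\<in>?I. 1/3)"
        unfolding g_def using lam_unique[OF sum1 refl] k by simp
      ultimately show False by simp
    qed
    ultimately show ?thesis by simp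
  qed
  \<comment> \<open>The other three values sum to 0, so each \<open>d $ i\<close> equals the total;
    summing over \<open>i\<close>, the total is four times itself, hence 0.\<close>
  have eq: "d $ i = (\<Sum>m\<in>UNIV. d $ m)" for i
    using sum0[of i] by (simp add: sum.remove[of UNIV i] Compl_eq_Diff_UNIV)
  have "(\<Sum>i\<in>UNIV. d $ i) = (\<Sum>i\<in>(UNIV::4 set). \<Sum>m\<in>UNIV. d $ m)"
    by (intro sum.cong refl eq)
  then have "(\<Sum>i\<in>UNIV. d $ i) = 0" by simp
  then have "d $ i = 0" for i using eq[of i] by simp
  then show ?thesis by (simp add: vec_eq_iff)
qed

lemma Phi_eq: "Phi v = range (\<lambda>(c, d). lin_field c + bubble_field d)"
  unfolding Phi_def face_UNIV[symmetric] vpolys_on_1 grad_bubble_space by auto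

end

section \<open>Dimension, directness and unisolvence from injectivity on coefficients\<close>

theorem lemma2p1:
  fixes v :: "4 \<Rightarrow> real^3"
    and T :: "(real^3) set"
    and t n :: "(real^3) set \<Rightarrow> real^3"
  assumes nondegenerate: "inj v" "\<not> affine_dependent (range v)"
    and T: "T = convex hull (range v)"
    and t: "\<And>e. e edge_of T \<Longrightarrow> unit_tangent e (t e)"
    and n: "\<And>F. F facet_of T \<Longrightarrow> unit_normal F (n F)"
  shows "vpolys_on 1 T \<inter> grad_bubble_space v = {0} \<and>
    (\<Sum>e\<in>{e. e edge_of T}. dim (polys_on 1 e)) + card {F. F facet_of T} = dim (Phi v) \<and>
    (\<forall>u\<in>Phi v.
      (\<forall>e. e edge_of T \<longrightarrow>
        (\<forall>q\<in>polys_on 1 e. line_integral e (\<lambda>x. (u x \<bullet> t e) * q x) = 0)) \<and>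
      (\<forall>F. F facet_of T \<longrightarrow> surface_integral F (\<lambda>x. u x \<bullet> n F) = 0) \<longrightarrow>
      u = 0)"
proof -
  interpret tetrahedron v by standard (fact nondegenerate)+
  have T: "T = face UNIV" by (simp add: T face_UNIV)
  let ?L = "\<lambda>(c, d). lin_field c + bubble_field d"
  have edge: "face I edge_of T" if "card I = 2" for I using that edges T by blast
  have facet: "face (-{i}) facet_of T" for i using facets T by blast
  \<comment> \<open>Stated for coefficients rather than fields, so that it also yields injectivity
    of the parametrization.\<close>
  have unisolvent: "c = 0 \<and> d = 0"
    if e: "\<And>e q. e edge_of T \<Longrightarrow> q \<in> polys_on 1 e \<Longrightarrow> line_integral e (\<lambda>x. (?L (c, d) x \<bullet> t e) * q x) = 0"
      and F: "\<And>F. F facet_of T \<Longrightarrow> surface_integral F (\<lambda>x. ?L (c, d) x \<bullet> n F) = 0" for c d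
  proof
    show c: "c = 0"
      by (rule edge_moments_eq_0_imp_coeffs_0[where t = t and d = d]) (use e t edge in auto)
    show "d = 0"
      by (rule facet_fluxes_eq_0_imp_coeffs_0[where n = n])
        (use F n facet c linear_0[OF linear_lin_field] in auto)
  qed
  have flat0: "flat_integral TYPE('k::euclidean_space) M (\<lambda>x. 0) = 0" for M
    by (simp add: flat_integral_def Let_def)
  \<comment> \<open>All degrees of freedom of the zero field vanish, so \<open>unisolvent\<close>
    applies to any coefficients representing it.\<close>
  have kernel: "c = 0 \<and> d = 0" if "?L (c, d) = 0" for c d
    by (rule unisolvent; simp only: that zero_fun_apply inner_zero_left mult_zero_left flat0)
  have lin: "linear ?L"
    by (rule linearI) (auto simp: linear_add[OF linear_lin_field] linear_scale[OF linear_lin_field]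
        linear_add[OF linear_bubble_field] linear_scale[OF linear_bubble_field] scaleR_add_right)
  have inj: "inj ?L"
    unfolding linear_injective_0[OF lin] using kernel by (auto simp: zero_prod_def)
  have direct: "vpolys_on 1 T \<inter> grad_bubble_space v = {0}"
  proof -
    \<comment> \<open>A common element represents 0 with the coefficients \<open>c\<close> and
      \<open>- d\<close>.\<close>
    have "lin_field c = 0" if "lin_field c = bubble_field d" for c d
      using kernel[of c "- d"] that by (simp add: linear_neg[OF linear_bubble_field] linear_0[OF linear_lin_field])
    moreover have "0 \<in> range lin_field" "0 \<in> range bubble_field"
      using linear_0[OF linear_lin_field] linear_0[OF linear_bubble_field] by (metis rangeI)+
    ultimately show ?thesis unfolding T vpolys_on_1 grad_bubble_space by auto
  qed
  have "dim (Phi v) = DIM((real^3^4) \<times> (real^4))"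
    using dim_linear_image_inj[OF lin inj] by (simp add: Phi_eq)
  then have "dim (Phi v) = 16" by simp
  moreover have "(\<Sum>e\<in>{e. e edge_of T}. dim (polys_on 1 e)) = 12"
  proof -
    \<comment> \<open>Six edges, the two-element subsets of four vertices, contribute 2
      each.\<close>
    have "(\<Sum>e\<in>{e. e edge_of T}. dim (polys_on 1 e)) = (\<Sum>I\<in>{I::4 set. card I = 2}. card I)"
      unfolding T edges by (simp add: sum.reindex inj_on_subset[OF inj_face] dim_polys_on_face del: One_nat_def)
    also have "\<dots> = 2 * card {I::4 set. card I = 2}" by simp
    also have "\<dots> = 12"
      using n_subsets[of "UNIV::4 set" 2] by (simp add: choose_two)
    finally show ?thesis .
  qed
  moreover have "card {F. F facet_of T} = 4"
  proof -
    have "inj (\<lambda>i::4. face (-{i}))" using inj_face by (auto simp: inj_def)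
    then show ?thesis unfolding T facets by (simp add: card_image)
  qed
  moreover have "u = 0" if "u \<in> Phi v"
      and "\<forall>e. e edge_of T \<longrightarrow> (\<forall>q\<in>polys_on 1 e. line_integral e (\<lambda>x. (u x \<bullet> t e) * q x) = 0)"
      and "\<forall>F. F facet_of T \<longrightarrow> surface_integral F (\<lambda>x. u x \<bullet> n F) = 0" for u
  proof -
    obtain c d where u: "u = ?L (c, d)" using \<open>u \<in> Phi v\<close> unfolding Phi_eq by auto
    then have "c = 0 \<and> d = 0" using that by (intro unisolvent) auto
    then show ?thesis using u linear_0[OF linear_lin_field] linear_0[OF linear_bubble_field] by simp
  qed
  ultimately show ?thesis using direct by simp
qed

end
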